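(* There exists a constant $C > 0$ such that for all integers $n \geq 3$, there exists a polytope $P$ with at most $n$ vertices, dimension at most $n^{C\sqrt{\frac{\log\log n}{\log n}}}$, and extension complexity \[ \mathrm{xc}(P) \geq n^{1 - C\sqrt{\frac{\log\log n}{\log n}}}. \]
   Context: $\log$ denotes the logarithm in base 2. A polytope is the convex hull of a finite set of points in some $\mathbb{R}^d$. The extension complexity $\mathrm{xc}(P)$ of a $d$-dimensional polytope $P$ is the minimum number of facets of a polytope $P'\subseteq\mathbb{R}^{d'}$ (for any $d'$) such that $P$ is the projection of $P'$ onto some $d$-dimensional subspace; equivalently, such that $P$ is the image of $P'$ under an affine map. *)

theory Defs
  imports "HOL-Analysis.Analysis" "HOL-Library.Function_Algebras"
begin

text \<open>The dimensions of the ambient spaces are quantified inside the statement, so they cannot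
  be type indices. All spaces \<open>\<real>\<^sup>d\<close> are therefore taken as the coordinate subspaces
  \<open>Rspace d\<close> of the real vector space of sequences \<open>nat \<Rightarrow> real\<close>. The library notions \<^const>\<open>polytope\<close>,
  \<^const>\<open>face_of\<close> and \<^const>\<open>extreme_point_of\<close> are purely algebraic and apply to this type directly.\<close>

instantiation "fun" :: (type, real_vector) real_vector
begin

definition scaleR_fun :: "real \<Rightarrow> ('a \<Rightarrow> 'b) \<Rightarrow> 'a \<Rightarrow> 'b"
  where "scaleR_fun c f = (\<lambda>x. c *\<^sub>R f x)"

instance
  by standard (auto simp: scaleR_fun_def plus_fun_def fun_eq_iff algebra_simps)

end

definition Rspace :: "nat \<Rightarrow> (nat \<Rightarrow> real) set"
  where "Rspace d = {x. \<forall>i\<ge>d. x i = 0}"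

text \<open>The library's \<^const>\<open>aff_dim\<close> and \<^const>\<open>facet_of\<close> require a Euclidean space type;
  the following versions only need a real vector space. They are meant for sets whose
  affine hull is finite-dimensional (\<^const>\<open>dim\<close> is 0 on infinite-dimensional sets), and
  agree with the library notions on Euclidean spaces.\<close>

definition affdim :: "'a::real_vector set \<Rightarrow> int"
  where "affdim S = (if S = {} then - 1 else int (dim {x - y |x y. x \<in> S \<and> y \<in> S}))"

definition is_facet_of :: "'a::real_vector set \<Rightarrow> 'a set \<Rightarrow> bool"
  where "is_facet_of F S \<longleftrightarrow> F face_of S \<and> F \<noteq> {} \<and> affdim F = affdim S - 1"

lemma affdim_eq_aff_dim: "affdim S = aff_dim S" for S :: "'a::euclidean_space set"
proof (cases "S = {}")
  case False
  then obtain a where a: "a \<in> S" by blast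
  let ?D = "{x - y |x y. x \<in> S \<and> y \<in> S}" and ?A = "(\<lambda>x. x - a) ` S"
  have "?D \<subseteq> span ?A"
  proof clarify
    fix x y assume "x \<in> S" "y \<in> S"
    then have "(x - a) - (y - a) \<in> span ?A"
      by (intro span_diff span_base) auto
    then show "x - y \<in> span ?A" by simp
  qed
  moreover have "?A \<subseteq> span ?D"
    using a by (auto intro!: span_base)
  ultimately have "span ?D = span ?A"
    unfolding span_eq by (rule conjI)
  then have "dim ?D = dim ?A"
    by (rule span_eq_dim)
  then show ?thesis
    using False aff_dim_eq_dim_subtract[OF hull_inc[OF a, of affine]]
    by (simp add: affdim_def)
qed (simp add: affdim_def)

lemma is_facet_of_eq_facet_of: "is_facet_of F S \<longleftrightarrow> F facet_of S"
  for S :: "'a::euclidean_space set"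
  by (simp add: is_facet_of_def facet_of_def affdim_eq_aff_dim)

definition affine_map :: "nat \<Rightarrow> nat \<Rightarrow> ((nat \<Rightarrow> real) \<Rightarrow> (nat \<Rightarrow> real)) \<Rightarrow> bool"
  where "affine_map m d f \<longleftrightarrow>
    (\<exists>g c. linear g \<and> g ` Rspace m \<subseteq> Rspace d \<and> c \<in> Rspace d \<and>
           (\<forall>x\<in>Rspace m. f x = g x + c))"

text \<open>The set below is nonempty for every polytope \<open>P\<close> in \<open>Rspace d\<close>, since \<open>P\<close> is an extension
  of itself; facet sets of polytopes are finite, so \<^const>\<open>card\<close> is their true number.\<close>

definition extension_complexity :: "nat \<Rightarrow> (nat \<Rightarrow> real) set \<Rightarrow> nat"
  where "extension_complexity d P =
    Inf {card {F. is_facet_of F Q} |Q.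
           \<exists>m f. Q \<subseteq> Rspace m \<and> polytope Q \<and> affine_map m d f \<and> f ` Q = P}"

end

theory Submission
  imports Defs
begin

text \<open>
  The polytopes come from a version of the unique disjointness problem over an alphabet of size \<open>q\<close>. A word \<open>a\<close>
  of length \<open>k\<close> over the alphabet is compared with a \<open>k\<close>-tuple \<open>b\<close> of subsets of the alphabet, and
  \<open>hits a b\<close> counts the positions at which the letter lies in the subset. Since \<open>(1 - hits a b)\<^sup>2\<close> is quadratic in
  the 0/1 incidence vector of \<open>a\<close>, the tensor squares of the \<open>q\<^sup>k\<close> incidence vectors have as
  convex hull a polytope of dimension at most \<open>(k * q)\<^sup>2\<close> on which each \<open>b\<close> gives a valid inequality with exactly these numbers as slacks
  at the vertices.

  If the polytope is the projection of some \<open>Q\<close>, every facet of \<open>Q\<close> yields a combinatorial rectangle of pairs \<open>(a, b)\<close> without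
  zero slack, that is, without a pair hitting exactly once. These rectangles, together with one more, cover all pairs that
  hit zero times. This needs only that a vertex outside a face is separated from it by a facet
  containing the face (\<open>facet_separating_face_from_point\<close>).

  The lower bound is then a counting argument. By induction on \<open>k\<close>, in the spirit of the short
  proof of Kaibel and Weltge for the correlation polytope, a rectangle without pairs hitting exactly once contains at most
  \<open>(2\<^sup>q (1 + t))\<^sup>k\<close> of the \<open>(q 2\<^bsup>q - 1\<^esup>)\<^sup>k\<close> disjoint pairs whenever \<open>q \<le> 2\<^sup>t\<close>
  (\<open>card_disjoint_pairs_le\<close>). So the extension complexity is at least about \<open>(q / (2 (1 + t)))\<^sup>k\<close>, which
  is the number \<open>q\<^sup>k\<close> of words up to a factor \<open>(2 (1 + t))\<^sup>k\<close>. With \<open>q = 2\<^sup>t\<close>, a large \<open>q\<close> increases the dimension and a small \<open>q\<close>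
  (hence a large \<open>k\<close>) increases this factor; for \<open>t\<close> about \<open>sqrt (log n * log (log n))\<close> and \<open>q\<^sup>k\<close> about \<open>n\<close> both
  are \<open>2\<close> to the power \<open>O(t)\<close>.
\<close>

section \<open>Faces and facets of polytopes in real vector spaces\<close>

text \<open>Differences of two points of \<open>S\<close> are differences of translated points, so any base point in \<open>S\<close>
  gives the same span. A fixed base point makes dimensions comparable for nested faces.\<close>

lemma affdim_conv_dim_translate:
  assumes "a \<in> S"
  shows "affdim S = int (dim ((\<lambda>x. x - a) ` S))"
proof -
  let ?D = "{x - y |x y. x \<in> S \<and> y \<in> S}" and ?A = "(\<lambda>x. x - a) ` S"
  have "?D \<subseteq> span ?A"
  proof clarify
    fix x y assume "x \<in> S" "y \<in> S"
    then have "(x - a) - (y - a) \<in> span ?A"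
      by (intro span_diff span_base) auto
    then show "x - y \<in> span ?A" by simp
  qed
  moreover have "?A \<subseteq> span ?D"
    using assms by (auto intro!: span_base)
  ultimately have "span ?D = span ?A"
    unfolding span_eq by (rule conjI)
  then show ?thesis
    using assms by (auto simp: affdim_def dest: span_eq_dim)
qed

lemma dim_insert_notin_span:
  fixes V :: "'a::real_vector set"
  assumes "finite S" "V \<subseteq> span S" "x \<notin> span V"
  shows "dim (insert x V) = dim V + 1"
proof -
  obtain B where B: "B \<subseteq> V" "independent B" "V \<subseteq> span B" "card B = dim V"
    by (rule basis_exists)
  have "finite B"
    using independent_span_bound[OF assms(1) B(2)] B(1) assms(2) by blast
  have sp: "span B = span V"
    using B by (simp add: span_eq span_superset subset_trans)
  then have "x \<notin> span B" using assms by simp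
  then have "independent (insert x B)" "x \<notin> B"
    using B by (auto simp: independent_insert span_base)
  moreover have "span (insert x B) = span (insert x V)"
    using sp by (simp add: span_insert)
  ultimately show ?thesis
    using \<open>finite B\<close> B(4) dim_eq_card[of "insert x B" "insert x V"] by simp
qed

lemma exists_functional_vanishing_on_span:
  fixes w :: "'a::real_vector"
  assumes "w \<notin> span W"
  obtains h :: "'a \<Rightarrow> real" where "linear h" "\<And>x. x \<in> W \<Longrightarrow> h x = 0" "h w = 1"
proof -
  obtain B where B: "B \<subseteq> W" "independent B" "W \<subseteq> span B"
    by (metis basis_exists)
  have sp: "span B = span W"
    using B by (simp add: span_eq span_superset subset_trans)
  then have "independent (insert w B)" "w \<notin> B"
    using B assms by (auto simp: independent_insert span_base)
  then obtain h :: "'a \<Rightarrow> real" where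
    h: "linear h" "\<And>x. x \<in> insert w B \<Longrightarrow> h x = (if x = w then 1 else 0)"
    using linear_independent_extend[of "insert w B" "\<lambda>x. if x = w then 1 else 0"] by blast
  have "h x = 0" if "x \<in> W" for x
  proof (rule linear_eq_0_on_span[OF h(1), of B])
    show "h y = 0" if "y \<in> B" for y using h(2)[of y] that \<open>w \<notin> B\<close> by auto
  qed (use B(3) that in auto)
  then show ?thesis using that h by auto
qed

lemma face_of_supporting_functional:
  fixes l :: "'a::real_vector \<Rightarrow> real"
  assumes "convex Q" "linear l" "\<And>x. x \<in> Q \<Longrightarrow> l x \<le> c"
  shows "{x \<in> Q. l x = c} face_of Q"
  unfolding face_of_def
proof (intro conjI ballI impI)
  show "convex {x \<in> Q. l x = c}"
    using assms(1) unfolding convex_def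
    by (auto simp: linear_add[OF assms(2)] linear_scale[OF assms(2)] distrib_right[symmetric])
next
  fix a b x assume *: "a \<in> Q" "b \<in> Q" "x \<in> {x \<in> Q. l x = c}" "x \<in> open_segment a b"
  then obtain u where u: "0 < u" "u < 1" "x = (1 - u) *\<^sub>R a + u *\<^sub>R b"
    by (auto simp: in_segment)
  have "l x = (1 - u) * l a + u * l b"
    by (simp only: u(3) linear_add[OF assms(2)] linear_scale[OF assms(2)] real_scaleR_def)
  then have "(1 - u) * (c - l a) + u * (c - l b) = 0"
    using *(3) by (simp add: algebra_simps)
  moreover have "(1 - u) * (c - l a) \<ge> 0" "u * (c - l b) \<ge> 0"
    using u assms(3)[OF *(1)] assms(3)[OF *(2)] by auto
  ultimately have "(1 - u) * (c - l a) = 0" "u * (c - l b) = 0" by linarith+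
  then show "a \<in> {x \<in> Q. l x = c}" "b \<in> {x \<in> Q. l x = c}"
    using u * by auto
qed auto

lemma linear_le_on_convex_hull:
  fixes l :: "'a::real_vector \<Rightarrow> real"
  assumes "linear l" "\<And>s. s \<in> S \<Longrightarrow> l s \<le> c" "x \<in> convex hull S"
  shows "l x \<le> c"
proof -
  have "convex {x. l x \<le> c}"
    using assms(1) unfolding convex_def
    by (auto simp: linear_add linear_scale intro: convex_bound_le)
  then have "convex hull S \<subseteq> {x. l x \<le> c}"
    using assms(2) by (intro hull_minimal) auto
  then show ?thesis using assms(3) by auto
qed

lemma translated_convex_hull_subset_span:
  fixes S :: "'a::real_vector set"
  assumes "\<And>s. s \<in> S \<Longrightarrow> s - p \<in> span W"
  shows "(\<lambda>x. x - p) ` (convex hull S) \<subseteq> span W"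
proof -
  have "convex ((\<lambda>x. p + x) ` span W)"
    by (intro convex_translation subspace_imp_convex) simp
  moreover have "(\<lambda>x. p + x) ` span W = {x. x - p \<in> span W}"
    by (force simp: image_iff)
  ultimately have "convex hull S \<subseteq> {x. x - p \<in> span W}"
    using assms by (intro hull_minimal) auto
  then show ?thesis by auto
qed

text \<open>A nonempty proper face of a polytope is the intersection of the facets containing it; this is the part of that fact
  which bounds extension complexity, in an arbitrary real vector space. Among the functionals that are
  valid on \<open>Q\<close>, tight on the given face and strict at \<open>v\<close>, take one that is tight at as many generators
  as possible, and let \<open>G\<close> be its face. If \<open>G\<close> and \<open>v\<close> together do not affinely span \<open>Q\<close>, some functional \<open>h\<close> is constant
  on \<open>G \<union> {v}\<close> and larger at some generator. Tilting by a positive multiple of \<open>h\<close> until a new generator becomes tight keeps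
  everything tight on \<open>G\<close> and leaves the slack at \<open>v\<close> unchanged, contradicting maximality. Hence
  \<open>G\<close> has codimension one.\<close>

lemma facet_separating_face_from_point:
  fixes l :: "'a::real_vector \<Rightarrow> real"
  assumes "polytope Q" "linear l" "\<And>x. x \<in> Q \<Longrightarrow> l x \<le> c"
    and "p \<in> Q" "l p = c" and "v \<in> Q" "l v < c"
  obtains G where "is_facet_of G Q" "{x \<in> Q. l x = c} \<subseteq> G" "v \<notin> G"
proof -
  obtain S where S: "finite S" "Q = convex hull S"
    using assms(1) by (auto simp: polytope_def)
  define good where "good = (\<lambda>(m, d :: real). linear m \<and> (\<forall>x\<in>Q. m x \<le> d) \<and>
     {x \<in> Q. l x = c} \<subseteq> {x \<in> Q. m x = d} \<and> m v < d)"
  define tight where "tight = (\<lambda>(m, d). {s \<in> S. m s = (d::real)})"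
  have "good (l, c)" using assms by (auto simp: good_def)
  moreover have "\<forall>y. good y \<longrightarrow> card (tight y) < Suc (card S)"
    using S(1) by (auto simp: tight_def less_Suc_eq_le intro!: card_mono)
  ultimately obtain md where md: "good md" "\<And>y. good y \<Longrightarrow> card (tight y) \<le> card (tight md)"
    using ex_has_greatest_nat[of good "(l, c)" "\<lambda>y. card (tight y)"] by blast
  obtain m d where [simp]: "md = (m, d)" by (cases md)
  have m: "linear m" "\<And>x. x \<in> Q \<Longrightarrow> m x \<le> d" "{x \<in> Q. l x = c} \<subseteq> {x \<in> Q. m x = d}" "m v < d"
    using md(1) by (auto simp: good_def)
  define G where "G = {x \<in> Q. m x = d}"
  have p: "p \<in> G" "m p = d" using m(3) assms unfolding G_def by auto
  let ?tr = "\<lambda>x. x - p"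
  define W where "W = insert (v - p) (?tr ` G)"
  have W: "s - p \<in> span W" if "s \<in> S" for s
  proof (rule ccontr)
    assume "s - p \<notin> span W"
    then obtain h :: "'a \<Rightarrow> real" where
      h: "linear h" "\<And>x. x \<in> W \<Longrightarrow> h x = 0" "h (s - p) = 1"
      by (rule exists_functional_vanishing_on_span) blast
    have hG: "h x = h p" if "x \<in> G" for x
      using h(2)[of "x - p"] that by (simp add: W_def linear_diff[OF h(1)])
    have hv: "h v = h p"
      using h(2)[of "v - p"] by (simp add: W_def linear_diff[OF h(1)])
    define T where "T = {s \<in> S. h s > h p}"
    define r where "r = (\<lambda>s. (d - m s) / (h s - h p))"
    have T: "finite T" "s \<in> T" "T \<subseteq> S"
      using S(1) \<open>s \<in> S\<close> h(3) by (auto simp: T_def linear_diff[OF h(1)])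
    have SQ: "S \<subseteq> Q" unfolding S(2) by (rule hull_subset)
    \<comment> \<open>\<open>r x\<close> is the amount of tilting at which \<open>x\<close> becomes tight; the least one keeps all of \<open>Q\<close> valid.\<close>
    define t where "t = Min (r ` T)"
    have "t \<in> r ` T" unfolding t_def using T by (intro Min_in) auto
    then obtain s0 where s0: "s0 \<in> T" "t = r s0" by blast
    have rpos: "r x > 0" if "x \<in> T" for x
    proof -
      have "x \<notin> G" using hG[of x] that by (auto simp: T_def)
      then have "m x < d" using m(2)[of x] that SQ by (force simp: T_def G_def)
      then show ?thesis using that by (simp add: r_def T_def)
    qed
    have t: "t > 0" using rpos s0 by auto
    have tmin: "t \<le> r x" if "x \<in> T" for x
      using that T by (auto simp: t_def)
    define m' where "m' = (\<lambda>x. m x + t * h x)"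
    define d' where "d' = d + t * h p"
    have lin: "linear m'"
      unfolding m'_def using m(1) linear_compose_scale_right[OF h(1), of t]
      by (intro linear_compose_add) simp_all
    have le: "m' x \<le> d'" if "x \<in> S" for x
    proof (cases "x \<in> T")
      case True
      then have "t * (h x - h p) \<le> d - m x"
        using tmin[OF True] by (simp add: r_def T_def field_simps)
      then show ?thesis by (simp add: m'_def d'_def algebra_simps)
    next
      case False
      then have "h x \<le> h p" using that by (auto simp: T_def)
      then have "t * h x \<le> t * h p" using t by simp
      then show ?thesis using m(2)[of x] SQ that by (auto simp: m'_def d'_def)
    qed
    have leQ: "m' x \<le> d'" if "x \<in> Q" for x
      using linear_le_on_convex_hull[OF lin le] that S(2) by auto
    have eqG: "m' x = d'" if "x \<in> G" for x
      using hG[OF that] that by (simp add: m'_def d'_def G_def)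
    have "good (m', d')"
      using lin leQ eqG m(3,4) hv unfolding good_def G_def
      by (auto simp: m'_def d'_def)
    moreover have "card (tight md) < card (tight (m', d'))"
    proof (rule psubset_card_mono)
      show "finite (tight (m', d'))" using S(1) by (simp add: tight_def)
      have "tight md \<subseteq> tight (m', d')"
        using eqG SQ by (auto simp: tight_def G_def)
      moreover have "s0 \<in> tight (m', d')"
        using s0 by (auto simp: tight_def T_def m'_def d'_def r_def field_simps)
      moreover have "s0 \<notin> tight md"
        using rpos[OF s0(1)] by (auto simp: tight_def r_def)
      ultimately show "tight md \<subset> tight (m', d')" by blast
    qed
    ultimately show False using md(2) by force
  qed
  have "?tr ` Q \<subseteq> span W"
    unfolding S(2) using W by (rule translated_convex_hull_subset_span)
  moreover have "W \<subseteq> ?tr ` Q" using assms by (auto simp: W_def G_def)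
  ultimately have "span (?tr ` Q) = span W"
    by (metis span_eq span_superset subset_trans)
  then have dQ: "dim (?tr ` Q) = dim W" by (rule span_eq_dim)
  have nin: "v - p \<notin> span (?tr ` G)"
  proof
    assume "v - p \<in> span (?tr ` G)"
    moreover have "m y = 0" if "y \<in> ?tr ` G" for y
      using that p(2) by (force simp: G_def linear_diff[OF m(1)])
    ultimately have "m (v - p) = 0"
      using linear_eq_0_on_span[OF m(1)] by blast
    then show False using m(4) p by (simp add: linear_diff[OF m(1)])
  qed
  have "?tr ` Q \<subseteq> span (?tr ` S)"
    unfolding S(2) by (rule translated_convex_hull_subset_span) (auto intro: span_base)
  then have "?tr ` G \<subseteq> span (?tr ` S)" by (auto simp: G_def)
  then have "dim W = dim (?tr ` G) + 1"
    unfolding W_def using S(1) nin by (intro dim_insert_notin_span) auto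
  then have "affdim G = affdim Q - 1"
    using p(1) assms(4) dQ by (simp add: affdim_conv_dim_translate)
  moreover have "G face_of Q"
    unfolding G_def using m S(2) by (intro face_of_supporting_functional) auto
  ultimately have "is_facet_of G Q"
    using p(1) by (auto simp: is_facet_of_def)
  moreover have "v \<notin> G" using m(4) by (auto simp: G_def)
  ultimately show ?thesis using that m(3) by (auto simp: G_def)
qed

text \<open>Every generator with positive weight in a convex combination lying on a face lies on that face:
  the point is in an open segment from the generator to the normalised rest of the combination.\<close>

lemma face_of_convex_hull_eq_hull_Int:
  fixes S :: "'a::real_vector set"
  assumes "finite S" "F face_of convex hull S"
  shows "F = convex hull (S \<inter> F)"
proof
  show "convex hull (S \<inter> F) \<subseteq> F"
    using face_of_imp_convex[OF assms(2)] by (intro hull_minimal) auto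
  show "F \<subseteq> convex hull (S \<inter> F)"
  proof
    fix x assume x: "x \<in> F"
    then have "x \<in> convex hull S" using assms(2) face_of_imp_subset by blast
    then obtain u where u: "\<And>s. s \<in> S \<Longrightarrow> 0 \<le> u s" "sum u S = 1" "(\<Sum>s\<in>S. u s *\<^sub>R s) = x"
      using assms(1) by (auto simp: convex_hull_finite)
    have inF: "s \<in> F" if s: "s \<in> S" "u s \<noteq> 0" for s
    proof (cases "u s = 1")
      case True
      then have "sum u (S - {s}) = 0"
        using u(2) assms(1) s by (simp add: sum_diff1)
      then have "\<forall>r\<in>S - {s}. u r = 0"
        using u(1) assms(1) by (subst (asm) sum_nonneg_eq_0_iff) auto
      then have "(\<Sum>r\<in>S. u r *\<^sub>R r) = u s *\<^sub>R s"
        using assms(1) s by (intro sum.remove[THEN trans]) auto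
      then show ?thesis using u(3) True x by simp
    next
      case False
      have sm: "sum u (S - {s}) = 1 - u s"
        using u(2) assms(1) s by (simp add: sum_diff1)
      have "sum u (S - {s}) \<ge> 0" using u(1) by (intro sum_nonneg) auto
      then have us: "0 < u s" "u s < 1" using sm False s u(1)[of s] by auto
      define y where "y = (\<Sum>r\<in>S - {s}. (u r / (1 - u s)) *\<^sub>R r)"
      have y: "y \<in> convex hull S"
        unfolding y_def using assms(1) us u(1)
        by (intro convex_sum) (auto simp: sum_divide_distrib[symmetric] sm intro: hull_inc)
      have "x = u s *\<^sub>R s + (\<Sum>r\<in>S - {s}. u r *\<^sub>R r)"
        using u(3) sum.remove[OF assms(1) s(1), of "\<lambda>r. u r *\<^sub>R r"] by simp
      also have "(\<Sum>r\<in>S - {s}. u r *\<^sub>R r) = (1 - u s) *\<^sub>R y"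
        using us by (simp add: y_def scaleR_sum_right)
      finally have xe: "x = (1 - u s) *\<^sub>R y + u s *\<^sub>R s" by simp
      show ?thesis
      proof (cases "y = s")
        case True
        then show ?thesis using xe x by (simp add: scaleR_add_left[symmetric])
      next
        case False
        then have "x \<in> open_segment y s" using xe us by (auto simp: in_segment)
        then show ?thesis
          using assms(2) x y hull_inc[OF s(1), of convex] unfolding face_of_def by blast
      qed
    qed
    have "x = (\<Sum>s\<in>S \<inter> F. u s *\<^sub>R s)"
      unfolding u(3)[symmetric] using inF assms(1) by (intro sum.mono_neutral_right) auto
    moreover have "sum u (S \<inter> F) = 1"
      unfolding u(2)[symmetric] using inF assms(1) by (intro sum.mono_neutral_left) auto
    ultimately show "x \<in> convex hull (S \<inter> F)"
      using u(1) assms(1) by (auto intro!: convex_sum intro: hull_inc)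
  qed
qed

text \<open>Needed because \<^const>\<open>card\<close> is 0 on infinite sets, so only finiteness turns a cover by facets into
  a lower bound on the count.\<close>

lemma finite_facets_of_polytope:
  fixes Q :: "'a::real_vector set"
  assumes "polytope Q"
  shows "finite {G. is_facet_of G Q}"
proof -
  obtain S where S: "finite S" "Q = convex hull S"
    using assms by (auto simp: polytope_def)
  have "{G. is_facet_of G Q} \<subseteq> (\<lambda>T. convex hull T) ` Pow S"
    using face_of_convex_hull_eq_hull_Int[OF S(1)] S(2) unfolding is_facet_of_def by blast
  then show ?thesis using S(1) finite_subset by blast
qed

section \<open>Rectangles in which no pair meets exactly once\<close>

text \<open>The number of positions at which a letter of the word lies in the subset at the same position. It
  is the size of the intersection of two sets: the graph of the word, and the disjoint union of the subsets.\<close>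

fun hits :: "'a list \<Rightarrow> 'a set list \<Rightarrow> nat" where
  "hits (x # xs) (S # Ss) = of_bool (x \<in> S) + hits xs Ss"
| "hits _ _ = 0"

definition words :: "'a set \<Rightarrow> nat \<Rightarrow> 'a list set" where
  "words Q k = {xs. set xs \<subseteq> Q \<and> length xs = k}"

definition disjoint_pairs :: "'a list set \<Rightarrow> 'a set list set \<Rightarrow> ('a list \<times> 'a set list) set" where
  "disjoint_pairs A B = {(a, b). a \<in> A \<and> b \<in> B \<and> hits a b = 0}"

lemma finite_words [simp]: "finite Q \<Longrightarrow> finite (words Q k)"
  by (simp add: words_def finite_lists_length_eq)

lemma words_0: "words Q 0 = {[]}"
  by (auto simp: words_def)

lemma Cons_in_words_Suc: "x # xs \<in> words Q (Suc k) \<longleftrightarrow> x \<in> Q \<and> xs \<in> words Q k"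
  by (auto simp: words_def)

lemma words_Suc: "words Q (Suc k) = (\<lambda>(x, xs). x # xs) ` (Q \<times> words Q k)"
  by (auto simp: words_def length_Suc_conv image_iff)

lemma hits_eq_sum:
  assumes "length a = k" "length b = k"
  shows "hits a b = (\<Sum>i<k. of_bool (a ! i \<in> b ! i))"
  using assms
proof (induction a b arbitrary: k rule: hits.induct)
  case (1 x xs S Ss)
  then show ?case
    by (cases k) (auto simp: sum.lessThan_Suc_shift simp del: sum.lessThan_Suc)
qed auto

lemma finite_disjoint_pairs:
  assumes "finite A" "finite B"
  shows "finite (disjoint_pairs A B)"
  by (rule finite_subset[OF _ finite_cartesian_product[OF assms]]) (auto simp: disjoint_pairs_def)

text \<open>Here \<open>x\<close> is the size of a set of letters and \<open>y\<close> the size of a family of subsets avoiding all of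
  them. If \<open>x \<le> t\<close> the first summand alone suffices; if \<open>x > t\<close> there are so few subsets,
  at most \<open>2\<^bsup>q - x\<^esup> \<le> 2\<^sup>q / q\<close>, that the second one does.\<close>

lemma mult_le_of_disjoint_letters:
  fixes q t x y :: nat
  assumes "x + m \<le> q" "y \<le> 2 ^ m" "q \<le> 2 ^ t"
  shows "q * (x * y) \<le> q * t * (if x = 0 then 0 else y) + 2 ^ q * (if y = 0 then 0 else x)"
proof (cases "x \<le> t")
  case True
  then have "q * (x * y) \<le> q * (t * y)" by (intro mult_le_mono) auto
  then show ?thesis by (cases "x = 0") (auto simp: mult.assoc intro: trans_le_add1)
next
  case False
  then have "q \<le> 2 ^ x" 
    using assms(3) by (meson nat_le_linear one_le_numeral order_trans power_increasing)
  then have "q * y \<le> 2 ^ x * 2 ^ m" using assms(2) by (intro mult_le_mono)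
  also have "\<dots> \<le> 2 ^ q" using assms(1) by (simp add: power_add[symmetric])
  finally have "(q * y) * x \<le> 2 ^ q * x" by (intro mult_le_mono) auto
  then show ?thesis by (cases "y = 0") (auto simp: mult_ac intro: trans_le_add2)
qed

text \<open>Double counting over pairs and the combinatorial rectangles \<open>A j \<times> B j\<close> that contain them.\<close>

lemma sum_card_cover_le:
  assumes "finite D" "finite J" "\<And>j. card {(a, b) \<in> D. a \<in> A j \<and> b \<in> B j} \<le> K"
  shows "(\<Sum>(a, b)\<in>D. card {j \<in> J. a \<in> A j \<and> b \<in> B j}) \<le> card J * K"
proof -
  have "(\<Sum>(a, b)\<in>D. card {j \<in> J. a \<in> A j \<and> b \<in> B j})
      = (\<Sum>p\<in>D. card {j \<in> J. fst p \<in> A j \<and> snd p \<in> B j})"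
    by (simp add: case_prod_unfold)
  also have "\<dots> = (\<Sum>j\<in>J. card {p \<in> D. fst p \<in> A j \<and> snd p \<in> B j})"
    using assms(1,2) by (intro sum_multicount_gen) auto
  also have "\<dots> \<le> card J * K"
    using sum_bounded_above[of J _ K] assms(3) by (simp add: case_prod_unfold)
  finally show ?thesis .
qed

text \<open>The combinatorial core: a rectangle \<open>A \<times> B\<close> in which no pair meets exactly once contains only few
  disjoint pairs, at most a fraction \<open>(2 (1 + t) / q)\<^sup>k\<close> of all of them.

  The induction peels off the first position. For a disjoint pair \<open>(a, b)\<close> of tails, no admissible
  first letter may belong to an admissible first subset, as this would create a pair meeting exactly once. Thus
  all \<open>|X a| \<sqdot> |Y b|\<close> extensions are disjoint, and \<open>Y b\<close> consists of subsets avoiding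
  \<open>X a\<close>. The tails are covered in two ways by rectangles that again have no pair
  meeting once: one rectangle per subset \<open>S\<close>, counting a pair \<open>|Y b|\<close> times unless \<open>X a\<close> is empty, and one per letter \<open>x\<close>,
  counting it \<open>|X a|\<close> times unless \<open>Y b\<close> is empty. Both counts are bounded by the induction hypothesis, and the
  preceding inequality bounds the product \<open>|X a| \<sqdot> |Y b|\<close> by a combination of them.\<close>

lemma card_disjoint_pairs_le:
  fixes Q :: "'a set"
  assumes Q: "finite Q" "card Q = q" "q > 0" and t: "q \<le> 2 ^ t"
    and "A \<subseteq> words Q k" "B \<subseteq> words (Pow Q) k"
    and "\<And>a b. a \<in> A \<Longrightarrow> b \<in> B \<Longrightarrow> hits a b \<noteq> 1"
  shows "card (disjoint_pairs A B) \<le> (2 ^ q * (1 + t)) ^ k"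
  using assms(5-)
proof (induction k arbitrary: A B)
  case 0
  then have "disjoint_pairs A B \<subseteq> {([], [])}"
    by (auto simp: disjoint_pairs_def words_0)
  then have "card (disjoint_pairs A B) \<le> card {([]::'a list, []::'a set list)}"
    by (intro card_mono) auto
  then show ?case by simp
next
  case (Suc k)
  let ?K = "(2 ^ q * (1 + t)) ^ k"
  define X where "X = (\<lambda>a. {x. x # a \<in> A})"
  define Y where "Y = (\<lambda>b. {S. S # b \<in> B})"
  have X: "X a \<subseteq> Q" and Y: "Y b \<subseteq> Pow Q" for a b
    using Suc.prems(1,2) Cons_in_words_Suc[of _ a Q k] Cons_in_words_Suc[of _ b "Pow Q" k]
    unfolding X_def Y_def by blast+
  have fX: "finite (X a)" and fY: "finite (Y b)" for a b
    using X Y Q(1) by (meson finite_subset finite_Pow_iff)+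
  define D where "D = disjoint_pairs (words Q k) (words (Pow Q) k)"
  have fD: "finite D" unfolding D_def using Q(1) by (intro finite_disjoint_pairs) auto
  have sep: "x \<notin> S" if "(a, b) \<in> D" "x \<in> X a" "S \<in> Y b" for a b x S
    using that Suc.prems(3)[of "x # a" "S # b"]
    by (auto simp: D_def disjoint_pairs_def X_def Y_def)
  have not1: "x \<in> S" if "x \<in> X a" "S \<in> Y b" "hits a b = 1" for a b x S
    using that Suc.prems(3)[of "x # a" "S # b"]
    by (auto simp: X_def Y_def)

  have "disjoint_pairs A B =
      (\<lambda>((a, b), (x, S)). (x # a, S # b)) ` (SIGMA (a, b):D. X a \<times> Y b)" (is "?L = ?R")
  proof
    show "?L \<subseteq> ?R"
    proof clarify
      fix u v assume uv: "(u, v) \<in> disjoint_pairs A B"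
      then have "u \<in> words Q (Suc k)" "v \<in> words (Pow Q) (Suc k)"
        using Suc.prems(1,2) by (auto simp: disjoint_pairs_def)
      then obtain x a S b where "u = x # a" "v = S # b" "a \<in> words Q k" "b \<in> words (Pow Q) k"
        unfolding words_Suc by auto
      with uv show "(u, v) \<in> ?R"
        by (auto simp: disjoint_pairs_def D_def X_def Y_def image_iff split: if_splits)
    qed
    show "?R \<subseteq> ?L"
      using sep by (force simp: D_def X_def Y_def disjoint_pairs_def)
  qed
  then have "card (disjoint_pairs A B) = card (SIGMA (a, b):D. X a \<times> Y b)"
    by (simp only: card_image inj_on_def) (subst card_image, auto simp: inj_on_def)
  also have "\<dots> = (\<Sum>(a, b)\<in>D. card (X a) * card (Y b))"
    using fD fX fY by (subst card_SigmaI) (auto simp: card_cartesian_product intro!: sum.cong)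
  finally have split: "card (disjoint_pairs A B) = (\<Sum>(a, b)\<in>D. card (X a) * card (Y b))" .

  have byS: "(\<Sum>(a, b)\<in>D. if card (X a) = 0 then 0 else card (Y b)) \<le> 2 ^ q * ?K"
  proof -
    \<comment> \<open>A pair in \<open>AS S \<times> BS S\<close> meeting once would extend, by some \<open>x \<notin> S\<close>, to one in \<open>A \<times> B\<close>.\<close>
    define AS where "AS = (\<lambda>S. {a \<in> words Q k. \<exists>x\<in>X a. x \<notin> S})"
    define BS where "BS = (\<lambda>S. {b \<in> words (Pow Q) k. S \<in> Y b})"
    have "(\<Sum>(a, b)\<in>D. if card (X a) = 0 then 0 else card (Y b))
        = (\<Sum>(a, b)\<in>D. card {S \<in> Pow Q. a \<in> AS S \<and> b \<in> BS S})"
    proof (intro sum.cong refl, clarify)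
      fix a b assume ab: "(a, b) \<in> D"
      then have "a \<in> words Q k" "b \<in> words (Pow Q) k" by (auto simp: D_def disjoint_pairs_def)
      then have "{S \<in> Pow Q. a \<in> AS S \<and> b \<in> BS S} = (if card (X a) = 0 then {} else Y b)"
        using sep[OF ab] Y[of b] fX[of a] unfolding AS_def BS_def by auto
      then show "(if card (X a) = 0 then 0 else card (Y b))
          = card {S \<in> Pow Q. a \<in> AS S \<and> b \<in> BS S}" by simp
    qed
    also have "\<dots> \<le> card (Pow Q) * ?K"
    proof (rule sum_card_cover_le)
      fix S
      have "{(a, b) \<in> D. a \<in> AS S \<and> b \<in> BS S} = disjoint_pairs (AS S) (BS S)"
        by (auto simp: D_def disjoint_pairs_def AS_def BS_def)
      moreover have "card (disjoint_pairs (AS S) (BS S)) \<le> ?K"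
        by (rule Suc.IH) (use not1 in \<open>auto simp: AS_def BS_def\<close>)
      ultimately show "card {(a, b) \<in> D. a \<in> AS S \<and> b \<in> BS S} \<le> ?K" by simp
    qed (use fD Q in auto)
    finally show ?thesis using Q by (simp add: card_Pow)
  qed

  have byx: "(\<Sum>(a, b)\<in>D. if card (Y b) = 0 then 0 else card (X a)) \<le> q * ?K"
  proof -
    define Ax where "Ax = (\<lambda>x. {a \<in> words Q k. x \<in> X a})"
    define Bx where "Bx = (\<lambda>x. {b \<in> words (Pow Q) k. \<exists>S\<in>Y b. x \<notin> S})"
    have "(\<Sum>(a, b)\<in>D. if card (Y b) = 0 then 0 else card (X a))
        = (\<Sum>(a, b)\<in>D. card {x \<in> Q. a \<in> Ax x \<and> b \<in> Bx x})"
    proof (intro sum.cong refl, clarify)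
      fix a b assume ab: "(a, b) \<in> D"
      then have "a \<in> words Q k" "b \<in> words (Pow Q) k" by (auto simp: D_def disjoint_pairs_def)
      then have "{x \<in> Q. a \<in> Ax x \<and> b \<in> Bx x} = (if card (Y b) = 0 then {} else X a)"
        using sep[OF ab] X[of a] fY[of b] unfolding Ax_def Bx_def by auto
      then show "(if card (Y b) = 0 then 0 else card (X a))
          = card {x \<in> Q. a \<in> Ax x \<and> b \<in> Bx x}" by simp
    qed
    also have "\<dots> \<le> card Q * ?K"
    proof (rule sum_card_cover_le)
      fix x
      have "{(a, b) \<in> D. a \<in> Ax x \<and> b \<in> Bx x} = disjoint_pairs (Ax x) (Bx x)"
        by (auto simp: D_def disjoint_pairs_def Ax_def Bx_def)
      moreover have "card (disjoint_pairs (Ax x) (Bx x)) \<le> ?K"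
        by (rule Suc.IH) (use not1 in \<open>auto simp: Ax_def Bx_def\<close>)
      ultimately show "card {(a, b) \<in> D. a \<in> Ax x \<and> b \<in> Bx x} \<le> ?K" by simp
    qed (use fD Q in auto)
    finally show ?thesis using Q by simp
  qed

  have "q * card (disjoint_pairs A B) = (\<Sum>(a, b)\<in>D. q * (card (X a) * card (Y b)))"
    by (simp add: split sum_distrib_left case_prod_unfold)
  also have "\<dots> \<le> (\<Sum>(a, b)\<in>D. q * t * (if card (X a) = 0 then 0 else card (Y b))
        + 2 ^ q * (if card (Y b) = 0 then 0 else card (X a)))"
  proof (intro sum_mono, clarify)
    fix a b assume ab: "(a, b) \<in> D"
    have "Y b \<subseteq> Pow (Q - X a)" using sep[OF ab] Y[of b] by auto
    then have "card (Y b) \<le> 2 ^ card (Q - X a)"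
      using Q(1) card_mono[of "Pow (Q - X a)" "Y b"] by (simp add: card_Pow)
    moreover have "card (X a) + card (Q - X a) \<le> q"
      using X[of a] Q card_mono[OF Q(1) X[of a]] by (simp add: card_Diff_subset fX)
    ultimately show "q * (card (X a) * card (Y b))
        \<le> q * t * (if card (X a) = 0 then 0 else card (Y b))
          + 2 ^ q * (if card (Y b) = 0 then 0 else card (X a))"
      using t by (intro mult_le_of_disjoint_letters)
  qed
  also have "\<dots> = q * t * (\<Sum>(a, b)\<in>D. if card (X a) = 0 then 0 else card (Y b))
        + 2 ^ q * (\<Sum>(a, b)\<in>D. if card (Y b) = 0 then 0 else card (X a))"
    by (simp only: case_prod_unfold sum.distrib sum_distrib_left)
  also have "\<dots> \<le> q * t * (2 ^ q * ?K) + 2 ^ q * (q * ?K)"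
    using byS byx by (intro add_mono mult_le_mono) auto
  also have "\<dots> = q * (2 ^ q * (1 + t)) ^ Suc k"
    by (simp add: algebra_simps)
  finally show ?case using Q(3) by simp
qed

lemma card_all_disjoint_pairs:
  assumes "finite Q"
  shows "card (disjoint_pairs (words Q k) (words (Pow Q) k)) = (card Q * 2 ^ (card Q - 1)) ^ k"
proof (induction k)
  case 0
  have "disjoint_pairs (words Q 0) (words (Pow Q) 0) = {([], [])}"
    by (auto simp: disjoint_pairs_def words_0)
  then show ?case by simp
next
  case (Suc k)
  let ?D = "disjoint_pairs (words Q k) (words (Pow Q) k)"
  let ?E = "SIGMA x:Q. Pow (Q - {x})"
  have "disjoint_pairs (words Q (Suc k)) (words (Pow Q) (Suc k))
      = (\<lambda>((a, b), (x, S)). (x # a, S # b)) ` (?D \<times> ?E)"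
    unfolding words_Suc disjoint_pairs_def by (auto simp: image_iff split: if_splits)
  then have "card (disjoint_pairs (words Q (Suc k)) (words (Pow Q) (Suc k))) = card (?D \<times> ?E)"
    by (simp only:) (subst card_image, auto simp: inj_on_def)
  moreover have "card ?E = card Q * 2 ^ (card Q - 1)"
    using assms by (subst card_SigmaI) (auto simp: card_Pow)
  ultimately show ?case by (simp add: Suc card_cartesian_product)
qed

section \<open>Extensions\<close>

lemma convex_Rspace: "convex (Rspace d)"
  by (auto simp: convex_def Rspace_def plus_fun_def scaleR_fun_def)

lemma affdim_le_of_subset_Rspace:
  assumes "P \<subseteq> Rspace d"
  shows "affdim P \<le> int d"
proof -
  define e where "e = (\<lambda>i j :: nat. of_bool (i = j) :: real)"
  have "x \<in> span (e ` {..<d})" if "x \<in> Rspace d" for x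
  proof -
    have apply_sum: "(\<Sum>i\<in>I. f i) j = (\<Sum>i\<in>I. f i j)" if "finite I" for I j and f :: "nat \<Rightarrow> nat \<Rightarrow> real"
      using that by induction (auto simp: plus_fun_def zero_fun_def)
    have "x = (\<Sum>i<d. x i *\<^sub>R e i)"
    proof
      fix j
      have "(\<Sum>i<d. x i *\<^sub>R e i) j = (\<Sum>i<d. if i = j then x i else 0)"
        by (auto simp: apply_sum scaleR_fun_def e_def intro!: sum.cong)
      also have "\<dots> = x j" using that by (auto simp: Rspace_def)
      finally show "x j = (\<Sum>i<d. x i *\<^sub>R e i) j" by simp
    qed
    then show ?thesis by (metis (no_types, lifting) span_sum span_scale span_base imageI)
  qed
  moreover have "{x - y |x y. x \<in> P \<and> y \<in> P} \<subseteq> Rspace d"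
  proof clarify
    fix x y assume "x \<in> P" "y \<in> P"
    then have "x \<in> Rspace d" "y \<in> Rspace d" using assms by auto
    then show "x - y \<in> Rspace d" by (simp add: Rspace_def)
  qed
  ultimately have "dim {x - y |x y. x \<in> P \<and> y \<in> P} \<le> card (e ` {..<d})"
    by (intro dim_le_card) auto
  also have "\<dots> \<le> d" using card_image_le[of "{..<d}" e] by simp
  finally show ?thesis by (simp add: affdim_def)
qed

lemma extension_complexity_attained:
  assumes "P \<subseteq> Rspace d" "polytope P"
  obtains m Q f where "Q \<subseteq> Rspace m" "polytope Q" "affine_map m d f" "f ` Q = P"
    "extension_complexity d P = card {F. is_facet_of F Q}"
proof -
  let ?X = "{card {F. is_facet_of F Q} |Q.
           \<exists>m f. Q \<subseteq> Rspace m \<and> polytope Q \<and> affine_map m d f \<and> f ` Q = P}"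
  have "affine_map d d id"
    unfolding affine_map_def
    by (intro exI[of _ id] exI[of _ 0]) (auto simp: Rspace_def zero_fun_def plus_fun_def linear_id)
  then have "card {F. is_facet_of F P} \<in> ?X" using assms by force
  then have "Inf ?X \<in> ?X" by (intro Inf_nat_def1) auto
  then show ?thesis using that unfolding extension_complexity_def by blast
qed

text \<open>A functional that is valid on the projection pulls back to one that is valid on the extension, up to the
  translation part of the affine map.\<close>

lemma facet_of_extension_separates:
  assumes Q: "Q \<subseteq> Rspace m" "polytope Q" "affine_map m d f"
    and l: "linear l" "\<And>x. x \<in> Q \<Longrightarrow> l (f x) \<le> (c :: real)"
    and "p \<in> Q" "l (f p) = c" "v \<in> Q" "l (f v) < c"
  obtains G where "is_facet_of G Q" "{x \<in> Q. l (f x) = c} \<subseteq> G" "v \<notin> G"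
proof -
  obtain g u where g: "linear g" "\<And>x. x \<in> Q \<Longrightarrow> f x = g x + u"
    using Q(1,3) unfolding affine_map_def by blast
  have lf: "l (f x) = (l \<circ> g) x + l u" if "x \<in> Q" for x
    using g(2)[OF that] by (simp add: linear_add[OF l(1)])
  have lin: "linear (l \<circ> g)" using g(1) l(1) by (rule linear_compose)
  obtain G where "is_facet_of G Q" "{x \<in> Q. (l \<circ> g) x = c - l u} \<subseteq> G" "v \<notin> G"
    using facet_separating_face_from_point[OF Q(2) lin, of "c - l u" p v] lf l(2) assms(6-9)
    by (smt (verit))
  moreover have "{x \<in> Q. l (f x) = c} = {x \<in> Q. (l \<circ> g) x = c - l u}"
    using lf by auto
  ultimately show ?thesis using that by auto
qed

section \<open>The polytope of words\<close>

text \<open>The 0/1 incidence vector of the word \<open>a\<close>, with \<open>k\<close> blocks of length \<open>q\<close>: coordinate \<open>i * q + x\<close> says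
  whether the letter at position \<open>i\<close> is \<open>x\<close>.\<close>

definition indicator_coord :: "nat \<Rightarrow> nat list \<Rightarrow> nat \<Rightarrow> real" where
  "indicator_coord q a r = of_bool (a ! (r div q) = r mod q)"

text \<open>The tensor square of the incidence vector, flattened row by row. In these coordinates quadratic
  functions of the incidence vector become linear functionals.\<close>

definition word_point :: "nat \<Rightarrow> nat \<Rightarrow> nat list \<Rightarrow> nat \<Rightarrow> real" where
  "word_point q N a m =
     (if m < N * N then indicator_coord q a (m div N) * indicator_coord q a (m mod N) else 0)"

definition subset_coord :: "nat \<Rightarrow> nat set list \<Rightarrow> nat \<Rightarrow> real" where
  "subset_coord q b r = of_bool (r mod q \<in> b ! (r div q))"

text \<open>The linearisation of \<open>2 h - h\<^sup>2\<close>, where \<open>h\<close> is the inner product with the incidence vector of \<open>b\<close>. The linear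
  term is read off the diagonal \<open>r * N + r\<close>, since a 0/1 coordinate equals its square.\<close>

definition hit_functional :: "nat \<Rightarrow> nat \<Rightarrow> nat set list \<Rightarrow> (nat \<Rightarrow> real) \<Rightarrow> real" where
  "hit_functional q N b v =
     2 * (\<Sum>r<N. subset_coord q b r * v (r * N + r))
     - (\<Sum>m<N * N. subset_coord q b (m div N) * subset_coord q b (m mod N) * v m)"

lemma linear_hit_functional: "linear (hit_functional q N b)"
  by (rule linearI)
    (auto simp: hit_functional_def plus_fun_def scaleR_fun_def algebra_simps
      sum.distrib sum_distrib_left)

lemma sum_div_mod:
  fixes F :: "nat \<Rightarrow> nat \<Rightarrow> 'a::comm_monoid_add"
  shows "(\<Sum>m<K * L. F (m div L) (m mod L)) = (\<Sum>r<K. \<Sum>s<L. F r s)"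
proof -
  have "(\<Sum>m<K * L. F (m div L) (m mod L)) = (\<Sum>r<K. \<Sum>m=r * L..<r * L + L. F (m div L) (m mod L))"
    by (simp add: sum.nat_group)
  also have "\<dots> = (\<Sum>r<K. \<Sum>s<L. F r s)"
  proof (rule sum.cong[OF refl])
    fix r
    have "(\<Sum>m=r * L..<r * L + L. F (m div L) (m mod L))
        = (\<Sum>s=0..<L. F ((s + r * L) div L) ((s + r * L) mod L))"
      using sum.shift_bounds_nat_ivl[of "\<lambda>m. F (m div L) (m mod L)" 0 "r * L" L]
      by (simp add: add.commute)
    also have "\<dots> = (\<Sum>s<L. F r s)" 
      by (intro sum.cong) auto
    finally show "(\<Sum>m=r * L..<r * L + L. F (m div L) (m mod L)) = (\<Sum>s<L. F r s)" .
  qed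
  finally show ?thesis .
qed

lemma hits_eq_inner_product:
  assumes "a \<in> words {..<q} k" "b \<in> words (Pow {..<q}) k"
  shows "(\<Sum>r<k * q. subset_coord q b r * indicator_coord q a r) = real (hits a b)"
proof -
  have "(\<Sum>r<k * q. subset_coord q b r * indicator_coord q a r)
      = (\<Sum>i<k. \<Sum>x<q. of_bool (x \<in> b ! i) * of_bool (a ! i = x))"
    unfolding subset_coord_def indicator_coord_def by (rule sum_div_mod)
  also have "\<dots> = (\<Sum>i<k. of_bool (a ! i \<in> b ! i))"
  proof (intro sum.cong refl)
    fix i assume "i \<in> {..<k}"
    then have "a ! i < q" using assms(1) by (auto simp: words_def dest!: nth_mem)
    moreover have "(\<Sum>x<q. of_bool (x \<in> b ! i) * of_bool (a ! i = x))
        = (\<Sum>x<q. if x = a ! i then of_bool (a ! i \<in> b ! i) else (0::real))"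
      by (intro sum.cong) auto
    ultimately show "(\<Sum>x<q. of_bool (x \<in> b ! i) * of_bool (a ! i = x))
        = (of_bool (a ! i \<in> b ! i) :: real)" by simp
  qed
  also have "\<dots> = real (hits a b)"
    using assms by (subst hits_eq_sum[of _ k]) (auto simp: words_def)
  finally show ?thesis .
qed

text \<open>The inequality \<open>hit_functional q (k * q) b \<le> 1\<close> is thus valid on all vertices, is tight exactly for words that
  meet \<open>b\<close> once, and has slack 1 for words that are disjoint from \<open>b\<close>.\<close>

lemma hit_functional_word_point:
  assumes "a \<in> words {..<q} k" "b \<in> words (Pow {..<q}) k"
  shows "hit_functional q (k * q) b (word_point q (k * q) a) = 1 - (1 - real (hits a b))\<^sup>2"
proof -
  let ?N = "k * q" and ?s = "subset_coord q b" and ?x = "indicator_coord q a"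
  have diag: "word_point q ?N a (r * ?N + r) = ?x r" if "r < ?N" for r
  proof -
    have "r * ?N + r < Suc r * ?N" using that by simp
    also have "\<dots> \<le> ?N * ?N" using that by (intro mult_le_mono) auto
    finally have "r * ?N + r < ?N * ?N" .
    moreover have "(r * ?N + r) div ?N = r" "(r * ?N + r) mod ?N = r"
      using that by (cases "k = 0"; cases "q = 0"; simp add: add.commute[of "r * ?N"])+
    ultimately show ?thesis
      by (simp add: word_point_def indicator_coord_def)
  qed
  have "(\<Sum>m<?N * ?N. ?s (m div ?N) * ?s (m mod ?N) * word_point q ?N a m)
      = (\<Sum>m<?N * ?N. (?s (m div ?N) * ?x (m div ?N)) * (?s (m mod ?N) * ?x (m mod ?N)))"
    by (intro sum.cong) (auto simp: word_point_def)
  also have "\<dots> = (\<Sum>r<?N. \<Sum>s<?N. (?s r * ?x r) * (?s s * ?x s))"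
    by (rule sum_div_mod)
  also have "\<dots> = (\<Sum>r<?N. ?s r * ?x r)\<^sup>2"
    by (simp add: power2_eq_square sum_product)
  finally have "(\<Sum>m<?N * ?N. ?s (m div ?N) * ?s (m mod ?N) * word_point q ?N a m)
      = (real (hits a b))\<^sup>2"
    using hits_eq_inner_product[OF assms] by simp
  moreover have "(\<Sum>r<?N. ?s r * word_point q ?N a (r * ?N + r)) = real (hits a b)"
    using hits_eq_inner_product[OF assms] diag by simp
  ultimately show ?thesis
    by (simp add: hit_functional_def power2_eq_square algebra_simps)
qed

definition word_polytope :: "nat \<Rightarrow> nat \<Rightarrow> (nat \<Rightarrow> real) set" where
  "word_polytope q k = convex hull (word_point q (k * q) ` words {..<q} k)"

lemma word_polytope_subset_Rspace: "word_polytope q k \<subseteq> Rspace ((k * q)\<^sup>2)"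
  unfolding word_polytope_def
  by (intro hull_minimal convex_Rspace) (auto simp: Rspace_def word_point_def power2_eq_square)

lemma polytope_word_polytope: "polytope (word_polytope q k)"
  unfolding word_polytope_def polytope_def by (metis finite_imageI finite_lessThan finite_words)

lemma card_words: "finite Q \<Longrightarrow> card (words Q k) = card Q ^ k"
  by (simp add: words_def card_lists_length_eq)

lemma card_extreme_points_word_polytope:
  "card {v. v extreme_point_of word_polytope q k} \<le> q ^ k"
proof -
  have "{v. v extreme_point_of word_polytope q k} \<subseteq> word_point q (k * q) ` words {..<q} k"
    unfolding word_polytope_def by (auto dest: extreme_point_of_convex_hull)
  then have "card {v. v extreme_point_of word_polytope q k}
      \<le> card (word_point q (k * q) ` words {..<q} k)"
    by (intro card_mono) auto
  also have "\<dots> \<le> card (words {..<q} k)" by (intro card_image_le) auto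
  finally show ?thesis by (simp add: card_words)
qed

lemma hit_functional_le_1:
  assumes "b \<in> words (Pow {..<q}) k" "x \<in> word_polytope q k"
  shows "hit_functional q (k * q) b x \<le> 1"
  using linear_hit_functional _ assms(2)[unfolded word_polytope_def]
proof (rule linear_le_on_convex_hull)
  fix s assume "s \<in> word_point q (k * q) ` words {..<q} k"
  then show "hit_functional q (k * q) b s \<le> 1"
    using hit_functional_word_point[OF _ assms(1)] by auto
qed

lemma extension_of_word_polytope_facet_separates:
  assumes Q: "Q \<subseteq> Rspace m" "polytope Q" "affine_map m d f" "f ` Q = word_polytope q k"
    and b: "b \<in> words (Pow {..<q}) k" and a0: "a0 \<in> words {..<q} k" "hits a0 b = 1"
    and a: "a \<in> words {..<q} k" "hits a b = 0"
    and v: "v \<in> Q" "f v = word_point q (k * q) a"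
  obtains G where "is_facet_of G Q" "{x \<in> Q. hit_functional q (k * q) b (f x) = 1} \<subseteq> G" "v \<notin> G"
proof -
  have "word_point q (k * q) a0 \<in> f ` Q"
    unfolding Q(4) word_polytope_def using a0 by (intro hull_inc) auto
  then obtain p where p: "p \<in> Q" "f p = word_point q (k * q) a0" by auto
  show ?thesis
  proof (rule facet_of_extension_separates[OF Q(1-3) linear_hit_functional, of q "k * q" b 1 p v])
    show "hit_functional q (k * q) b (f x) \<le> 1" if "x \<in> Q" for x
      using hit_functional_le_1[OF b] Q(4) that by blast
    show "hit_functional q (k * q) b (f p) = 1"
      using hit_functional_word_point[OF a0(1) b] p a0 by simp
    show "hit_functional q (k * q) b (f v) < 1"
      using hit_functional_word_point[OF a(1) b] v a by simp
  qed (use p v that in auto)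
qed

text \<open>Choose a preimage \<open>v a\<close> in \<open>Q\<close> of the vertex of each word \<open>a\<close>. Each facet \<open>G\<close> of \<open>Q\<close> gives the
  rectangle of the words whose preimage avoids \<open>G\<close> and the tuples whose tight face is inside \<open>G\<close>; it has no pair
  meeting exactly once, because the preimage of such a word lies on the tight face. By facet separation
  these rectangles cover the disjoint pairs whose tuple has a nonempty tight face. The other tuples meet no word exactly
  once and form one extra rectangle, which accounts for the \<open>+ 1\<close>. As every rectangle holds few disjoint
  pairs, there are many facets.\<close>

lemma card_facets_extension_ge:
  assumes Q: "Q \<subseteq> Rspace m" "polytope Q" "affine_map m d f" "f ` Q = word_polytope q k"
    and q: "q > 0" "q \<le> 2 ^ t"
  shows "q ^ k \<le> (card {G. is_facet_of G Q} + 1) * (2 * (1 + t)) ^ k"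
proof -
  let ?W = "words {..<q} k" and ?S = "words (Pow {..<q}) k" and ?K = "(2 ^ q * (1 + t)) ^ k"
  have "\<exists>v. v \<in> Q \<and> f v = word_point q (k * q) a" if "a \<in> ?W" for a
  proof -
    have "word_point q (k * q) a \<in> f ` Q"
      unfolding Q(4) word_polytope_def using that by (intro hull_inc) auto
    then show ?thesis by auto
  qed
  then obtain v where v: "\<And>a. a \<in> ?W \<Longrightarrow> v a \<in> Q \<and> f (v a) = word_point q (k * q) a"
    by metis
  define A where "A = (\<lambda>G. {a \<in> ?W. v a \<notin> G})"
  define B where "B = (\<lambda>G. {b \<in> ?S. {x \<in> Q. hit_functional q (k * q) b (f x) = 1} \<subseteq> G})"
  define B0 where "B0 = {b \<in> ?S. \<forall>a\<in>?W. hits a b \<noteq> 1}"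
  let ?F = "{G. is_facet_of G Q}"
  have fin: "finite ?F" by (rule finite_facets_of_polytope[OF Q(2)])
  have bound: "card (disjoint_pairs A' B') \<le> ?K"
    if "A' \<subseteq> ?W" "B' \<subseteq> ?S" "\<And>a b. a \<in> A' \<Longrightarrow> b \<in> B' \<Longrightarrow> hits a b \<noteq> 1" for A' B'
    using that q by (intro card_disjoint_pairs_le[of "{..<q}"]) auto
  have "disjoint_pairs ?W ?S \<subseteq> (\<Union>G\<in>?F. disjoint_pairs (A G) (B G)) \<union> disjoint_pairs ?W B0"
  proof clarify
    fix a b assume ab: "(a, b) \<in> disjoint_pairs ?W ?S" "(a, b) \<notin> disjoint_pairs ?W B0"
    then obtain a0 where "a0 \<in> ?W" "hits a0 b = 1"
      by (auto simp: disjoint_pairs_def B0_def)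
    with ab obtain G where "is_facet_of G Q"
      "{x \<in> Q. hit_functional q (k * q) b (f x) = 1} \<subseteq> G" "v a \<notin> G"
      using extension_of_word_polytope_facet_separates[OF Q, of b a0 a "v a"] v[of a]
      by (auto simp: disjoint_pairs_def)
    then show "(a, b) \<in> (\<Union>G\<in>?F. disjoint_pairs (A G) (B G))"
      using ab by (auto simp: disjoint_pairs_def A_def B_def)
  qed
  moreover have "finite ((\<Union>G\<in>?F. disjoint_pairs (A G) (B G)) \<union> disjoint_pairs ?W B0)"
    using fin by (auto intro!: finite_disjoint_pairs simp: A_def B_def B0_def)
  ultimately have "card (disjoint_pairs ?W ?S)
      \<le> card ((\<Union>G\<in>?F. disjoint_pairs (A G) (B G)) \<union> disjoint_pairs ?W B0)"
    by (rule card_mono[rotated])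
  also have "\<dots> \<le> card (\<Union>G\<in>?F. disjoint_pairs (A G) (B G)) + card (disjoint_pairs ?W B0)"
    by (rule card_Un_le)
  also have "card (\<Union>G\<in>?F. disjoint_pairs (A G) (B G)) \<le> (\<Sum>G\<in>?F. card (disjoint_pairs (A G) (B G)))"
    using fin by (rule card_UN_le)
  also have "\<dots> \<le> (\<Sum>G\<in>?F. ?K)"
  proof (intro sum_mono bound)
    fix G a b assume ab: "a \<in> A G" "b \<in> B G"
    show "hits a b \<noteq> 1"
    proof
      assume "hits a b = 1"
      then have "hit_functional q (k * q) b (f (v a)) = 1"
        using ab v[of a] hit_functional_word_point[of a q k b] by (auto simp: A_def B_def)
      then show False using ab v[of a] by (auto simp: A_def B_def)
    qed
  qed (auto simp: A_def B_def)
  also have "card (disjoint_pairs ?W B0) \<le> ?K"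
    by (intro bound) (auto simp: B0_def)
  finally have *: "(q * 2 ^ (q - 1)) ^ k \<le> (card ?F + 1) * ?K"
    using card_all_disjoint_pairs[of "{..<q}" k] by simp
  have "(2::nat) ^ q = 2 ^ (q - 1) * 2" using q(1) by (cases q) auto
  then have "?K = (2 * (1 + t)) ^ k * (2 ^ (q - 1)) ^ k"
    by (simp only: power_mult_distrib mult_ac)
  with * have "q ^ k * (2 ^ (q - 1)) ^ k \<le> ((card ?F + 1) * (2 * (1 + t)) ^ k) * (2 ^ (q - 1)) ^ k"
    by (simp only: power_mult_distrib[of q] mult.assoc)
  then show ?thesis by (subst (asm) mult_le_cancel2) simp
qed

lemma hits_replicate_empty: "hits a (replicate k {}) = 0"
proof (induction a arbitrary: k)
  case (Cons x a)
  then show ?case by (cases k) auto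
qed simp

text \<open>One positive slack next to a nonempty tight face already forces a facet. This absorbs the additive
  term of the previous bound, and settles the small values of \<open>n\<close>.\<close>

lemma facet_extension_exists:
  assumes Q: "Q \<subseteq> Rspace m" "polytope Q" "affine_map m d f" "f ` Q = word_polytope q k"
    and q: "q \<ge> 2" "k \<ge> 1"
  obtains G where "is_facet_of G Q"
proof -
  define b where "b = {0::nat} # replicate (k - 1) {}"
  define u where "u = (\<lambda>x::nat. x # replicate (k - 1) 0)"
  have b: "b \<in> words (Pow {..<q}) k" and u: "u 0 \<in> words {..<q} k" "u 1 \<in> words {..<q} k"
    using q by (auto simp: b_def u_def words_def)
  have "hits (u 0) b = 1" "hits (u 1) b = 0"
    by (simp_all add: u_def b_def hits_replicate_empty)
  moreover have "word_point q (k * q) (u 1) \<in> f ` Q"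
    unfolding Q(4) word_polytope_def using u by (intro hull_inc) auto
  then obtain v where "v \<in> Q" "f v = word_point q (k * q) (u 1)" by auto
  ultimately show ?thesis
    using extension_of_word_polytope_facet_separates[OF Q b u(1) _ u(2)] that by metis
qed

proposition extension_complexity_word_polytope:
  assumes "q \<ge> 2" "k \<ge> 1" "q \<le> 2 ^ t"
  shows "extension_complexity ((k * q)\<^sup>2) (word_polytope q k) \<ge> 1"
    and "q ^ k \<le> 2 * extension_complexity ((k * q)\<^sup>2) (word_polytope q k) * (2 * (1 + t)) ^ k"
proof -
  let ?x = "extension_complexity ((k * q)\<^sup>2) (word_polytope q k)"
  obtain m Q f where Q: "Q \<subseteq> Rspace m" "polytope Q" "affine_map m ((k * q)\<^sup>2) f"
    "f ` Q = word_polytope q k" and x: "?x = card {G. is_facet_of G Q}"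
    by (rule extension_complexity_attained[OF word_polytope_subset_Rspace polytope_word_polytope])
  obtain G where "is_facet_of G Q" by (rule facet_extension_exists[OF Q assms(1,2)])
  then have "{G. is_facet_of G Q} \<noteq> {}" by auto
  then show *: "?x \<ge> 1"
    unfolding x using finite_facets_of_polytope[OF Q(2)] by (simp add: Suc_le_eq card_gt_0_iff)
  have "q ^ k \<le> (?x + 1) * (2 * (1 + t)) ^ k"
    unfolding x using assms by (intro card_facets_extension_ge[OF Q]) auto
  also have "\<dots> \<le> 2 * ?x * (2 * (1 + t)) ^ k"
    using * by (intro mult_le_mono) auto
  finally show "q ^ k \<le> 2 * ?x * (2 * (1 + t)) ^ k" .
qed

section \<open>Choice of the alphabet size and word length\<close>

text \<open>Lower bounds that leave only two regimes: either \<open>L\<close> is large compared with \<open>log L\<close>, and then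
  \<open>log L \<ge> 1\<close>, or the square root in the exponent is more than 1/2.\<close>

lemma log_log_lower_bounds:
  fixes n :: nat
  assumes "n \<ge> 3" and L: "L = log 2 n" and M: "M = log 2 L"
  shows "L \<ge> 3/2" "M \<ge> 1/2" and "M < 1 \<Longrightarrow> L < 4 * M"
proof -
  have "2 powr (3/2) = sqrt (2 powr 3)" by (simp add: powr_half_sqrt_powr)
  also have "\<dots> = sqrt 8" by simp
  also have "\<dots> \<le> sqrt (3\<^sup>2)" by (intro real_sqrt_le_mono) simp
  also have "\<dots> \<le> real n" using assms(1) by simp
  finally show L32: "L \<ge> 3/2" unfolding L using assms(1) by (subst le_log_iff) auto
  have "2 powr (1/2) = sqrt 2" by (simp add: powr_half_sqrt)
  also have "\<dots> \<le> sqrt ((3/2)\<^sup>2)" by (intro real_sqrt_le_mono) (simp add: power2_eq_square)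
  also have "\<dots> \<le> L" using L32 by simp
  finally show "M \<ge> 1/2" unfolding M using L32 by (subst le_log_iff) auto
  then show "L < 4 * M" if "M < 1"
  proof -
    have "L < 2" using that L32 unfolding M by (simp add: log_less_iff)
    then show ?thesis using \<open>M \<ge> 1/2\<close> by simp
  qed
qed

text \<open>With \<open>R = sqrt (L * M)\<close>, an error factor \<open>2\<^bsup>O(R)\<^esup>\<close> is affordable. Rounding the word length \<open>k\<close> down so that
  \<open>(2\<^sup>t)\<^sup>k \<le> n\<close> costs a factor of at most \<open>2\<^sup>t\<close>, while the combinatorial bound loses a factor
  \<open>(2 (1 + t))\<^sup>k = 2\<^bsup>O(k M)\<^esup>\<close>. With \<open>k\<close> about \<open>L / t\<close>, both are \<open>2\<^bsup>O(R)\<^esup>\<close> for \<open>t\<close> about \<open>R\<close>.\<close>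

lemma parameters_exist:
  fixes n :: nat
  assumes "n \<ge> 3" and L: "L = log 2 n" and M: "M = log 2 L" and "4 * M \<le> L"
  defines "R \<equiv> sqrt (L * M)"
  obtains t k :: nat where "t \<ge> 1" "k \<ge> 1" "real ((2 ^ t) ^ k) \<le> n"
    "real ((k * 2 ^ t)\<^sup>2) \<le> 2 powr (6 * R)"
    "2 * real ((2 * (1 + t)) ^ k) * 2 powr (L - 6 * R) \<le> real ((2 ^ t) ^ k)"
proof -
  note sm = log_log_lower_bounds[OF assms(1) L M]
  have M1: "M \<ge> 1" using sm(3) assms(4) by linarith
  have L2: "L \<ge> 4" using M1 assms(4) by linarith
  have n: "real n = 2 powr L" using assms(1) by (simp add: L)
  have R: "R \<ge> M" "R \<le> L / 2" "R \<ge> 2"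
  proof -
    have "M * M \<le> L * M" using M1 assms(4) by (intro mult_right_mono) auto
    then show "R \<ge> M" unfolding R_def by (intro real_le_rsqrt) (simp add: power2_eq_square)
    have "L * M \<le> (L/2)\<^sup>2" using assms(4) L2 by (simp add: power2_eq_square)
    then show "R \<le> L / 2" unfolding R_def using L2 by (intro real_le_lsqrt) auto
    have "4 * 1 \<le> L * M" using L2 M1 by (intro mult_mono) auto
    then show "R \<ge> 2" unfolding R_def by (intro real_le_rsqrt) simp
  qed
  define t where "t = nat \<lceil>R\<rceil>"
  define k where "k = nat \<lfloor>L / t\<rfloor>"
  have t: "R \<le> t" "real t \<le> R + 1" unfolding t_def using R by linarith+
  have t1: "real t > 0" using t R by linarith
  have tL: "real t \<le> L" using t R L2 by linarith
  have "L / t \<ge> 1" using tL t1 by simp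
  then have k: "real k \<le> L / t" "L / t \<le> real k + 1" "k \<ge> 1"
    unfolding k_def by linarith+
  have tk: "real t * real k \<le> L" "L - t \<le> real t * real k"
    using k(1,2) t1 by (simp_all add: field_simps)
  have pow: "real ((2 ^ t) ^ k) = 2 powr (real t * real k)"
    by (simp add: powr_realpow[symmetric] powr_powr)
  have kM: "real k * M \<le> R"
  proof -
    have "real k * R \<le> L" using tk(1) t(1) by (smt (verit) mult.commute mult_right_mono of_nat_0_le_iff)
    then have "real k * R * M \<le> R * R" using M1 L2 by (simp add: R_def mult_right_mono)
    then show ?thesis using R(3) by (simp add: mult_ac)
  qed
  show ?thesis
  proof (rule that[of t k])
    show "t \<ge> 1" "k \<ge> 1" using t1 k by auto
    show "real ((2 ^ t) ^ k) \<le> n" unfolding pow n using tk by simp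
    have "real k \<le> R" using kM mult_left_mono[OF M1, of "real k"] by simp
    then have kL: "real k \<le> L" using R(2) L2 by linarith
    have LM: "L = 2 powr M" unfolding M using L2 by simp
    have "real (k * 2 ^ t) \<le> 2 powr M * 2 powr (R + 1)"
      using kL t(2) by (simp add: LM[symmetric] powr_realpow[symmetric] mult_mono)
    also have "\<dots> = 2 powr (M + (R + 1))" by (simp add: powr_add)
    also have "\<dots> \<le> 2 powr (3 * R)" using R by simp
    finally have "(real (k * 2 ^ t))\<^sup>2 \<le> (2 powr (3 * R))\<^sup>2" by (intro power_mono) auto
    also have "\<dots> = 2 powr (6 * R)" by (simp add: power2_eq_square powr_add[symmetric])
    finally show "real ((k * 2 ^ t)\<^sup>2) \<le> 2 powr (6 * R)" by simp
    have "real (2 * (1 + t)) \<le> 4 * L" using t R L2 by simp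
    also have "\<dots> = 2 powr (2 + M)" by (simp add: powr_add LM[symmetric])
    also have "\<dots> \<le> 2 powr (3 * M)" using M1 by simp
    finally have "real (2 * (1 + t)) ^ k \<le> (2 powr (3 * M)) ^ k" by (intro power_mono) auto
    also have "\<dots> = 2 powr (3 * M * real k)" by (simp add: powr_realpow[symmetric] powr_powr)
    finally have "2 * real ((2 * (1 + t)) ^ k) * 2 powr (L - 6 * R)
        \<le> 2 powr 1 * 2 powr (3 * M * real k) * 2 powr (L - 6 * R)"
      by simp
    also have "\<dots> = 2 powr (1 + 3 * M * real k + (L - 6 * R))" by (simp add: powr_add)
    also have "\<dots> \<le> 2 powr (real t * real k)"
    proof (intro powr_mono)
      have "3 * M * real k \<le> 3 * R" using kM by (simp add: mult_ac)
      then show "1 + 3 * M * real k + (L - 6 * R) \<le> real t * real k"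
        using tk(2) t R by linarith
    qed simp
    finally show "2 * real ((2 * (1 + t)) ^ k) * 2 powr (L - 6 * R) \<le> real ((2 ^ t) ^ k)"
      unfolding pow .
  qed
qed

theorem corollary14:
  shows "\<exists>C::real. C > 0 \<and> (\<forall>n::nat. n \<ge> 3 \<longrightarrow>
    (\<exists>d P. P \<subseteq> Rspace d \<and> polytope P
       \<and> card {v. v extreme_point_of P} \<le> n
       \<and> real_of_int (affdim P)
           \<le> real n powr (C * sqrt (log 2 (log 2 (real n)) / log 2 (real n)))
       \<and> real (extension_complexity d P)
           \<ge> real n powr (1 - C * sqrt (log 2 (log 2 (real n)) / log 2 (real n)))))"
proof (rule exI[of _ 6], rule conjI, simp, intro allI impI)
  fix n :: nat assume n3: "n \<ge> 3"
  define L where "L = log 2 (real n)"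
  define M where "M = log 2 L"
  define R where "R = sqrt (L * M)"
  note sm = log_log_lower_bounds[OF n3 L_def M_def]
  have n: "real n = 2 powr L" using n3 by (simp add: L_def)
  have LR: "L * sqrt (M / L) = R"
    using sm(1) real_sqrt_mult[of L M] real_div_sqrt[of L] by (simp add: R_def real_sqrt_divide field_simps)
  have up: "real n powr (6 * sqrt (M / L)) = 2 powr (6 * R)"
    by (simp add: n powr_powr LR[symmetric] mult_ac)
  have low: "real n powr (1 - 6 * sqrt (M / L)) = 2 powr (L - 6 * R)"
    by (simp add: n powr_powr LR[symmetric] algebra_simps)
  have "\<exists>q k. q ^ k \<le> n \<and> real ((k * q)\<^sup>2) \<le> 2 powr (6 * R) \<and>
      2 powr (L - 6 * R) \<le> real (extension_complexity ((k * q)\<^sup>2) (word_polytope q k))"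
  proof (cases "4 * M \<le> L")
    case True
    obtain t k :: nat where tk: "t \<ge> 1" "k \<ge> 1" "real ((2 ^ t) ^ k) \<le> n"
      "real ((k * 2 ^ t)\<^sup>2) \<le> 2 powr (6 * R)"
      "2 * real ((2 * (1 + t)) ^ k) * 2 powr (L - 6 * R) \<le> real ((2 ^ t) ^ k)"
      using parameters_exist[OF n3 L_def M_def True] unfolding R_def by blast
    have "(2::nat) ^ 1 \<le> 2 ^ t" using tk(1) by (intro power_increasing) auto
    then have "(2 ^ t) ^ k \<le> 2 * extension_complexity ((k * 2 ^ t)\<^sup>2) (word_polytope (2 ^ t) k) * (2 * (1 + t)) ^ k"
      (is "_ \<le> 2 * ?x * ?B") using tk(2) by (intro extension_complexity_word_polytope(2)) auto
    then have "real ((2 ^ t) ^ k) \<le> real (2 * ?x * ?B)" by (rule of_nat_mono)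
    also have "\<dots> = (2 * real ?B) * real ?x" by (simp only: of_nat_mult of_nat_numeral mult_ac)
    finally have "(2 * real ?B) * 2 powr (L - 6 * R) \<le> (2 * real ?B) * real ?x"
      by (rule order_trans[OF tk(5)])
    then have "2 powr (L - 6 * R) \<le> real ?x"
      by (rule mult_left_le_imp_le) simp
    then show ?thesis using tk(3,4) by (intro exI[of _ "2 ^ t"] exI[of _ k]) (simp del: of_nat_power)
  next
    \<comment> \<open>Here \<open>6 * sqrt (M / L) > 3\<close>, so the dimension bound exceeds \<open>n\<^sup>3\<close>, the required complexity
      is less than 1, and a segment is enough.\<close>
    case False
    have "(L / 2)\<^sup>2 \<le> L * M" using False sm(1) by (simp add: power2_eq_square)
    then have RL: "L / 2 \<le> R" unfolding R_def by (rule real_le_rsqrt)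
    then have "(2::real) powr 2 \<le> 2 powr (6 * R)" using sm(1) by (intro powr_mono) auto
    moreover have "2 powr (L - 6 * R) \<le> 2 powr 0" using RL sm(1) by (intro powr_mono) auto
    moreover have "1 \<le> extension_complexity ((1 * 2)\<^sup>2) (word_polytope 2 1)"
      by (rule extension_complexity_word_polytope(1)[of 2 1 1]) auto
    ultimately show ?thesis using n3 by (intro exI[of _ 2] exI[of _ 1]) auto
  qed
  then obtain q k where qk: "q ^ k \<le> n" "real ((k * q)\<^sup>2) \<le> 2 powr (6 * R)"
    "2 powr (L - 6 * R) \<le> real (extension_complexity ((k * q)\<^sup>2) (word_polytope q k))"
    by blast
  have "affdim (word_polytope q k) \<le> int ((k * q)\<^sup>2)"
    by (intro affdim_le_of_subset_Rspace word_polytope_subset_Rspace)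
  then have "real_of_int (affdim (word_polytope q k)) \<le> 2 powr (6 * R)"
    using qk(2) by (smt (verit) of_int_le_iff of_int_of_nat_eq)
  then show "\<exists>d P. P \<subseteq> Rspace d \<and> polytope P
       \<and> card {v. v extreme_point_of P} \<le> n
       \<and> real_of_int (affdim P)
           \<le> real n powr (6 * sqrt (log 2 (log 2 (real n)) / log 2 (real n)))
       \<and> real (extension_complexity d P)
           \<ge> real n powr (1 - 6 * sqrt (log 2 (log 2 (real n)) / log 2 (real n)))"
    using word_polytope_subset_Rspace polytope_word_polytope qk(3)
      order_trans[OF card_extreme_points_word_polytope qk(1)]
    unfolding L_def[symmetric] M_def[symmetric] up low by blast
qed

end
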